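(* Let $0<\alpha<1/2$ be fixed. For a positive integer $n$, let $D_\alpha(n)$ be the number of distinct distances determined by pairs of points of the rectangular lattice $$R_\alpha(n)=\{(i,j)\in\mathbb{Z}^2 \mid 0\le i\le n^{1-\alpha},\ 0\le j\le n^{\alpha}\}.$$ Then $D_\alpha(n)=\Theta(n)$ as $n\to\infty$; that is, there exist constants $c,C>0$ and $n_0$ (which may depend on $\alpha$) such that $c\,n\le D_\alpha(n)\le C\,n$ for all $n\ge n_0$.
   Context: Distances are Euclidean distances in the plane. The number of distinct distances determined by a finite point set $\mathcal{P}\subset\mathbb{R}^2$ is the number of distinct nonzero values $|pq|$ with $p,q\in\mathcal{P}$. *)

theory Defs
  imports "HOL-Analysis.Analysis"
begin

text \<open>The metric on the product type \<open>real \<times> real\<close> is the Euclidean one.\<close>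

definition num_distinct_distances :: "(real \<times> real) set \<Rightarrow> nat" where
  "num_distinct_distances P = card {d. d \<noteq> 0 \<and> (\<exists>p\<in>P. \<exists>q\<in>P. d = dist p q)}"

definition rect_lattice :: "real \<Rightarrow> nat \<Rightarrow> (real \<times> real) set" where
  "rect_lattice \<alpha> n =
     {(real_of_int i, real_of_int j) | i j.
        0 \<le> i \<and> real_of_int i \<le> real n powr (1 - \<alpha>) \<and>
        0 \<le> j \<and> real_of_int j \<le> real n powr \<alpha>}"

definition lattice_distances :: "real \<Rightarrow> nat \<Rightarrow> nat" where
  "lattice_distances \<alpha> n = num_distinct_distances (rect_lattice \<alpha> n)"

end

theory Submission
  imports Defs "HOL-Real_Asymp.Real_Asymp"
begin

text \<open>
  Up to the value \<open>0\<close>, the distances in the lattice are the numbers \<open>sqrt (x\<^sup>2 + y\<^sup>2)\<close> with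
  \<open>x \<le> n\<^sup>1\<^sup>-\<^sup>\<alpha>\<close> and \<open>y \<le> n\<^sup>\<alpha>\<close>, which gives the upper bound. A coincidence
  \<open>x\<^sup>2 + y\<^sup>2 = x'\<^sup>2 + y'\<^sup>2\<close> of two different points is a factorisation \<open>u v = k s\<close> with
  \<open>u = \<bar>y - y'\<bar>\<close>, \<open>v = y + y'\<close>, \<open>k = \<bar>x - x'\<bar>\<close>, \<open>s = x + x'\<close>; here \<open>u, v \<le> 2 n\<^sup>\<alpha>\<close>. Splitting
  \<open>u = k\<^sub>1 s\<^sub>1\<close>, \<open>v = k\<^sub>2 s\<^sub>2\<close>, \<open>k = k\<^sub>1 k\<^sub>2\<close>, \<open>s = s\<^sub>1 s\<^sub>2\<close> shows that there are
  only \<open>O(n\<^sup>2\<^sup>\<alpha> log\<^sup>2 n) = o(n)\<close> coincidences, because \<open>\<alpha> < 1/2\<close>. Hence almost all of the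
  \<open>n\<close> or more points have a distance to the origin shared by no other point.
\<close>

section \<open>Pairs of positive integers with bounded product\<close>

definition hyperbola_pairs :: "nat \<Rightarrow> (nat \<times> nat) set" where
  "hyperbola_pairs M = {(k, s). 0 < k \<and> 0 < s \<and> k * s \<le> M}"

lemma hyperbola_pairs_eq_Sigma: "hyperbola_pairs M = Sigma {1..M} (\<lambda>k. {1..M div k})"
proof -
  have "k \<le> M" if "0 < s" "k * s \<le> M" for k s :: nat
    using that by (cases s) auto
  moreover have "s \<le> M div k \<longleftrightarrow> k * s \<le> M" if "0 < k" for k s :: nat
    using that by (simp add: less_eq_div_iff_mult_less_eq mult.commute)
  ultimately show ?thesis
    unfolding hyperbola_pairs_def by (intro set_eqI) (simp add: Suc_le_eq split_paired_all, metis)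
qed

lemma finite_hyperbola_pairs [simp]: "finite (hyperbola_pairs M)"
  by (simp add: hyperbola_pairs_eq_Sigma)

lemma card_hyperbola_pairs_le: "real (card (hyperbola_pairs M)) \<le> real M * harm M"
proof -
  have "real (card (hyperbola_pairs M)) = (\<Sum>k=1..M. real (M div k))"
    by (simp add: hyperbola_pairs_eq_Sigma)
  also have "\<dots> \<le> (\<Sum>k=1..M. real M / real k)"
    by (intro sum_mono of_nat_div_le_of_nat)
  also have "\<dots> = real M * harm M"
    by (simp add: harm_def sum_distrib_left divide_inverse)
  finally show ?thesis .
qed

text \<open>The difference of \<open>harm n\<close> and \<open>ln n\<close> is decreasing in
  \<open>n\<close>, and at \<open>n = 1\<close> it equals 1.\<close>

lemma harm_le_ln:
  assumes "1 \<le> n"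
  shows "harm n \<le> 1 + ln (real n)"
proof -
  obtain m where "n = Suc m"
    using assms by (cases n) auto
  moreover have "harm (Suc m) - ln (real (Suc m)) \<le> harm (Suc 0) - ln (real (Suc 0))"
    using decseqD[OF decseq_harm_diff_ln, of 0 m] by simp
  ultimately show ?thesis
    by (simp add: harm_def)
qed

text \<open>Since \<open>k\<close> divides \<open>u * v\<close>, it is a product of a divisor
  \<open>k1\<close> of \<open>u\<close> and a divisor \<open>k2\<close> of \<open>v\<close>; the
  cofactors \<open>s1\<close>, \<open>s2\<close> multiply to \<open>s\<close> after cancelling
  \<open>k1 * k2\<close>, which is nonzero because \<open>u\<close> and \<open>v\<close>
  are.\<close>

lemma mult_eq_mult_split:
  fixes u v k s :: nat
  assumes "u * v = k * s" "0 < u" "0 < v"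
  obtains k1 s1 k2 s2
    where "u = k1 * s1" "v = k2 * s2" "k = k1 * k2" "s = s1 * s2"
      and "0 < k1" "0 < s1" "0 < k2" "0 < s2"
proof -
  have "k dvd u * v"
    using assms by simp
  then obtain k1 k2 where k: "k = k1 * k2" "k1 dvd u" "k2 dvd v"
    using division_decomp by blast
  then obtain s1 s2 where s: "u = k1 * s1" "v = k2 * s2"
    by (auto elim!: dvdE)
  then have pos: "0 < k1" "0 < s1" "0 < k2" "0 < s2"
    using assms by auto
  have "k1 * k2 * (s1 * s2) = k1 * k2 * s"
    using assms(1) k(1) s by (simp add: ac_simps)
  then have "s = s1 * s2"
    using pos by simp
  with k s pos that show thesis
    by blast
qed

section \<open>Points of equal squared norm\<close>

definition sqnorm :: "nat \<times> nat \<Rightarrow> nat" where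
  "sqnorm = (\<lambda>(x, y). x\<^sup>2 + y\<^sup>2)"

text \<open>Split the identity \<open>(y - y') * (y + y') = (x' - x) * (x + x')\<close>: every
  coordinate is half the sum or difference of two of its factors. The products
  \<open>k1 * s1 = y - y'\<close> and \<open>k2 * s2 = y + y'\<close> are at most
  \<open>2 * b\<close>, so the number of possible quadruples is controlled by \<open>b\<close>
  alone, however large \<open>x\<close> and \<open>x'\<close> are.\<close>

lemma sqnorm_eq_imp_factorisation:
  assumes "sqnorm (x, y) = sqnorm (x', y')" "y' < y" "y \<le> b"
  obtains k1 s1 k2 s2
    where "(k1, s1) \<in> hyperbola_pairs (2 * b)" "(k2, s2) \<in> hyperbola_pairs (2 * b)"
      and "x = (s1 * s2 - k1 * k2) div 2" "y = (k2 * s2 + k1 * s1) div 2"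
      and "x' = (s1 * s2 + k1 * k2) div 2" "y' = (k2 * s2 - k1 * s1) div 2"
proof -
  have eq: "x\<^sup>2 + y\<^sup>2 = x'\<^sup>2 + y'\<^sup>2"
    using assms by (simp add: sqnorm_def)
  have "y'\<^sup>2 < y\<^sup>2"
    using assms by (simp add: power_strict_mono)
  then have "x\<^sup>2 < x'\<^sup>2"
    using eq by linarith
  then have "x < x'"
    by (rule power_less_imp_less_base) simp
  then obtain u k where u: "y = y' + u" "0 < u" and k: "x' = x + k"
    using assms by (metis less_imp_add_positive)
  have "u * (y + y') = k * (x + x')"
    using eq unfolding u k by (simp add: power2_eq_square algebra_simps)
  moreover have "0 < y + y'"
    using u by simp
  ultimately obtain k1 s1 k2 s2
    where split: "u = k1 * s1" "y + y' = k2 * s2" "k = k1 * k2" "x + x' = s1 * s2"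
      and pos: "0 < k1" "0 < s1" "0 < k2" "0 < s2"
    using u(2) by (blast elim: mult_eq_mult_split)
  have "u \<le> 2 * b" "y + y' \<le> 2 * b"
    using u assms by auto
  then have "(k1, s1) \<in> hyperbola_pairs (2 * b)" "(k2, s2) \<in> hyperbola_pairs (2 * b)"
    using pos split by (auto simp: hyperbola_pairs_def)
  then show thesis
  proof (rule that)
    \<comment> \<open>With the products folded back, these read \<open>2 * x = (x + x') - k\<close>,
      \<open>2 * y = (y + y') + u\<close> and so on. Truncated subtraction is exact, as
      \<open>k \<le> x + x'\<close> and \<open>u \<le> y + y'\<close>.\<close>
    show "x = (s1 * s2 - k1 * k2) div 2" "y = (k2 * s2 + k1 * s1) div 2"
         "x' = (s1 * s2 + k1 * k2) div 2" "y' = (k2 * s2 - k1 * s1) div 2"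
      unfolding split(1,3)[symmetric] split(2,4)[symmetric] using u k by auto
  qed
qed

text \<open>Outside the set of colliding points \<open>f\<close> is injective.\<close>

lemma card_le_card_image_plus_collisions:
  assumes "finite A"
  shows "card A \<le> card (f ` A) + card {p \<in> A. \<exists>q\<in>A. q \<noteq> p \<and> f q = f p}"
proof -
  let ?B = "{p \<in> A. \<exists>q\<in>A. q \<noteq> p \<and> f q = f p}"
  have "inj_on f (A - ?B)"
    by (auto simp: inj_on_def)
  then have "card (A - ?B) = card (f ` (A - ?B))"
    by (simp add: card_image)
  also have "\<dots> \<le> card (f ` A)"
    using assms by (intro card_mono) auto
  finally show ?thesis
    using assms by (simp add: card_Diff_subset)
qed

text \<open>A colliding point is determined by two hyperbola pairs once it is known whether it is
  the upper or the lower point of the collision; these two cases (\<open>?f\<close> and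
  \<open>?g\<close>) give the factor 2.\<close>

lemma card_sqnorm_collisions_le:
  "card {p \<in> {..a} \<times> {..b}. \<exists>q\<in>{..a} \<times> {..b}. q \<noteq> p \<and> sqnorm q = sqnorm p}
     \<le> 2 * (card (hyperbola_pairs (2 * b)))\<^sup>2" (is "card ?B \<le> _")
proof -
  let ?T = "hyperbola_pairs (2 * b)"
  let ?f = "\<lambda>((k1, s1), k2, s2). ((s1 * s2 - k1 * k2) div 2, (k2 * s2 + k1 * s1) div 2) :: nat \<times> nat"
  let ?g = "\<lambda>((k1, s1), k2, s2). ((s1 * s2 + k1 * k2) div 2, (k2 * s2 - k1 * s1) div 2) :: nat \<times> nat"
  have "?B \<subseteq> ?f ` (?T \<times> ?T) \<union> ?g ` (?T \<times> ?T)"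
  proof
    fix p assume "p \<in> ?B"
    then obtain x y x' y' where p: "p = (x, y)" and le: "y \<le> b" "y' \<le> b"
      and ne: "(x', y') \<noteq> (x, y)" and eq: "sqnorm (x', y') = sqnorm (x, y)"
      by auto
    \<comment> \<open>Equal second coordinates would force \<open>x = x'\<close>, as both are
      natural numbers.\<close>
    have "y \<noteq> y'"
      using ne eq by (auto simp: sqnorm_def)
    then consider "y' < y" | "y < y'"
      by linarith
    then show "p \<in> ?f ` (?T \<times> ?T) \<union> ?g ` (?T \<times> ?T)"
    proof cases
      case 1
      obtain k1 s1 k2 s2 where T: "(k1, s1) \<in> ?T" "(k2, s2) \<in> ?T"
        and xy: "x = (s1 * s2 - k1 * k2) div 2" "y = (k2 * s2 + k1 * s1) div 2"
          "x' = (s1 * s2 + k1 * k2) div 2" "y' = (k2 * s2 - k1 * s1) div 2"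
        by (rule sqnorm_eq_imp_factorisation[OF eq[symmetric] 1 le(1)])
      have "p \<in> ?f ` (?T \<times> ?T)"
        by (rule image_eqI[of _ _ "((k1, s1), k2, s2)"]) (use p xy T in simp_all)
      then show ?thesis
        by blast
    next
      case 2
      obtain k1 s1 k2 s2 where T: "(k1, s1) \<in> ?T" "(k2, s2) \<in> ?T"
        and xy: "x' = (s1 * s2 - k1 * k2) div 2" "y' = (k2 * s2 + k1 * s1) div 2"
          "x = (s1 * s2 + k1 * k2) div 2" "y = (k2 * s2 - k1 * s1) div 2"
        by (rule sqnorm_eq_imp_factorisation[OF eq 2 le(2)])
      have "p \<in> ?g ` (?T \<times> ?T)"
        by (rule image_eqI[of _ _ "((k1, s1), k2, s2)"]) (use p xy T in simp_all)
      then show ?thesis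
        by blast
    qed
  qed
  then have "card ?B \<le> card (?f ` (?T \<times> ?T) \<union> ?g ` (?T \<times> ?T))"
    by (intro card_mono) auto
  also have "\<dots> \<le> card (?T \<times> ?T) + card (?T \<times> ?T)"
    by (intro order_trans[OF card_Un_le] add_mono card_image_le) auto
  finally show ?thesis
    by (simp add: card_cartesian_product power2_eq_square)
qed

lemma card_sqnorm_image_ge:
  assumes "1 \<le> b"
  shows "real (a + 1) * real (b + 1) - 2 * (real (2 * b) * (1 + ln (real (2 * b))))\<^sup>2
           \<le> real (card (sqnorm ` ({..a} \<times> {..b})))"
proof -
  let ?T = "hyperbola_pairs (2 * b)"
  have "real (card ?T) \<le> real (2 * b) * harm (2 * b)"
    by (rule card_hyperbola_pairs_le)
  also have "\<dots> \<le> real (2 * b) * (1 + ln (real (2 * b)))"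
    using assms by (intro mult_left_mono harm_le_ln) auto
  finally have "real (card ?T) \<le> real (2 * b) * (1 + ln (real (2 * b)))" .
  then have "(real (card ?T))\<^sup>2 \<le> (real (2 * b) * (1 + ln (real (2 * b))))\<^sup>2"
    by (intro power_mono) auto
  moreover have "(a + 1) * (b + 1) \<le> card (sqnorm ` ({..a} \<times> {..b})) + 2 * (card ?T)\<^sup>2"
    using card_le_card_image_plus_collisions[of "{..a} \<times> {..b}" sqnorm]
      card_sqnorm_collisions_le[of a b] by (simp add: card_cartesian_product)
  then have "real ((a + 1) * (b + 1)) \<le>
      real (card (sqnorm ` ({..a} \<times> {..b}))) + 2 * (real (card ?T))\<^sup>2"
    by (metis (mono_tags) of_nat_add of_nat_le_iff of_nat_mult of_nat_numeral of_nat_power)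
  ultimately show ?thesis
    unfolding of_nat_mult by linarith
qed

section \<open>From lattice distances to squared norms\<close>

lemma rect_lattice_eq_image:
  "rect_lattice \<alpha> n =
     (\<lambda>(x, y). (real x, real y)) ` ({..nat \<lfloor>real n powr (1 - \<alpha>)\<rfloor>} \<times> {..nat \<lfloor>real n powr \<alpha>\<rfloor>})"
  (is "_ = ?h ` (?X \<times> ?Y)")
proof (intro equalityI subsetI)
  fix p assume "p \<in> rect_lattice \<alpha> n"
  then obtain i j where ij: "p = (real_of_int i, real_of_int j)"
      "0 \<le> i" "real_of_int i \<le> real n powr (1 - \<alpha>)"
      "0 \<le> j" "real_of_int j \<le> real n powr \<alpha>"
    by (auto simp: rect_lattice_def)
  then have "p = ?h (nat i, nat j)" "(nat i, nat j) \<in> ?X \<times> ?Y"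
    by (auto simp: le_floor_iff nat_mono)
  then show "p \<in> ?h ` (?X \<times> ?Y)"
    by blast
next
  fix p assume "p \<in> ?h ` (?X \<times> ?Y)"
  then obtain x y where xy: "p = (real_of_int (int x), real_of_int (int y))"
      "x \<le> nat \<lfloor>real n powr (1 - \<alpha>)\<rfloor>" "y \<le> nat \<lfloor>real n powr \<alpha>\<rfloor>"
    by auto
  then have "real_of_int (int x) \<le> real n powr (1 - \<alpha>)" "real_of_int (int y) \<le> real n powr \<alpha>"
    by (simp_all add: le_nat_floor le_nat_iff le_floor_iff)
  with xy(1) show "p \<in> rect_lattice \<alpha> n"
    unfolding rect_lattice_def by fastforce
qed

text \<open>Translating and reflecting a difference vector moves it into the grid itself, so every
  distance is already a distance from the origin. As \<open>sqrt\<close> is injective, it suffices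
  to count squared norms; the subtracted 1 is the value 0.\<close>

lemma num_distinct_distances_grid:
  "num_distinct_distances ((\<lambda>(x, y). (real x, real y)) ` ({..a} \<times> {..b})) =
     card (sqnorm ` ({..a} \<times> {..b})) - 1"
proof -
  let ?h = "\<lambda>(x, y). (real x, real y)"
  let ?V = "sqnorm ` ({..a} \<times> {..b})"
  let ?f = "\<lambda>m. sqrt (real m)"
  have dist_grid: "dist (?h (x, y)) (?h (x', y')) = ?f (sqnorm (nat \<bar>int x - int x'\<bar>, nat \<bar>int y - int y'\<bar>))"
    for x y x' y'
    by (simp add: dist_prod_def dist_real_def sqnorm_def)
  have "{d. d \<noteq> 0 \<and> (\<exists>p\<in>?h ` ({..a} \<times> {..b}). \<exists>q\<in>?h ` ({..a} \<times> {..b}). d = dist p q)}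
      = ?f ` (?V - {0})" (is "?D = _")
  proof (intro equalityI subsetI)
    fix d assume "d \<in> ?D"
    then obtain x y x' y' where d: "d \<noteq> 0" "d = dist (?h (x, y)) (?h (x', y'))"
      and le: "x \<le> a" "y \<le> b" "x' \<le> a" "y' \<le> b"
      by auto
    let ?m = "sqnorm (nat \<bar>int x - int x'\<bar>, nat \<bar>int y - int y'\<bar>)"
    have dm: "d = ?f ?m"
      using d(2) dist_grid by simp
    then have "?m \<noteq> 0"
      using d(1) by (metis of_nat_0 real_sqrt_zero)
    moreover have "?m \<in> ?V"
      using le by (intro imageI) auto
    ultimately show "d \<in> ?f ` (?V - {0})"
      unfolding dm by (metis DiffI imageI singletonD)
  next
    fix d assume "d \<in> ?f ` (?V - {0})"
    then obtain m where m: "d = ?f m" "m \<in> ?V" "m \<noteq> 0"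
      by blast
    then obtain x y where xy: "x \<le> a" "y \<le> b" "m = sqnorm (x, y)"
      by auto
    have "d \<noteq> 0"
      using m by simp
    moreover have "d = dist (?h (x, y)) (?h (0, 0))"
      unfolding m(1) xy(3) by (subst dist_grid) simp
    moreover have "?h (x, y) \<in> ?h ` ({..a} \<times> {..b})" "?h (0, 0) \<in> ?h ` ({..a} \<times> {..b})"
      using xy by (intro imageI; simp)+
    ultimately show "d \<in> ?D"
      by blast
  qed
  moreover have "inj_on ?f (?V - {0})"
    by (auto simp: inj_on_def)
  moreover have "0 \<in> ?V"
    by (force simp: sqnorm_def)
  ultimately show ?thesis
    by (simp add: num_distinct_distances_def card_image)
qed

lemma lattice_distances_eq:
  "lattice_distances \<alpha> n =
     card (sqnorm ` ({..nat \<lfloor>real n powr (1 - \<alpha>)\<rfloor>} \<times> {..nat \<lfloor>real n powr \<alpha>\<rfloor>})) - 1"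
  by (simp add: lattice_distances_def rect_lattice_eq_image num_distinct_distances_grid)

section \<open>Asymptotics and the final estimate\<close>

lemma eventually_collisions_le:
  fixes \<alpha> :: real
  assumes "\<alpha> < 1/2"
  shows "eventually (\<lambda>n::nat.
    2 * (2 * real n powr \<alpha> * (1 + ln (2 * real n powr \<alpha>)))\<^sup>2 + 1 \<le> real n / 2) at_top"
proof -
  \<comment> \<open>The square root of the collision bound is compared with \<open>sqrt n\<close>;
    the quotient tends to 0 because \<alpha> < 1/2 leaves a power of \<open>n\<close> that beats the
    logarithm.\<close>
  have "((\<lambda>n::nat. real n powr \<alpha> * (1 + ln 2 + \<alpha> * ln (real n)) / real n powr (1/2)) \<longlonglongrightarrow> 0)"
    using assms by real_asymp
  then have "eventually (\<lambda>n::nat.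
      \<bar>real n powr \<alpha> * (1 + ln 2 + \<alpha> * ln (real n)) / real n powr (1/2)\<bar> < 1/8) at_top"
    by (auto dest: tendstoD[where e = "1/8"])
  with eventually_ge_at_top[of 4] show ?thesis
  proof eventually_elim
    case (elim n)
    define q where "q = real n powr \<alpha> * (1 + ln 2 + \<alpha> * ln (real n))"
    have "\<bar>q\<bar> \<le> 1/8 * real n powr (1/2)"
      using elim by (simp add: q_def abs_mult field_simps)
    then have "q\<^sup>2 \<le> (1/8 * real n powr (1/2))\<^sup>2"
      by (metis abs_ge_zero power2_abs power_mono)
    also have "\<dots> = real n / 64"
      by (simp add: powr_half_sqrt power_mult_distrib power_divide)
    \<comment> \<open>The threshold 1/8 gives \<open>8 * q\<^sup>2 \<le> n / 8\<close>, and
      \<open>n \<ge> 4\<close> leaves room for the additional 1.\<close>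
    finally have "8 * q\<^sup>2 + 1 \<le> real n / 2"
      using elim(1) by simp
    moreover have "ln (2 * real n powr \<alpha>) = ln 2 + \<alpha> * ln (real n)"
      using elim(1) by (simp add: ln_mult)
    ultimately show ?case
      by (simp add: q_def power_mult_distrib add.assoc)
  qed
qed

theorem theorem2p1:
  fixes \<alpha> :: real
  assumes "0 < \<alpha>" and "\<alpha> < 1/2"
  shows "\<exists>c>0. \<exists>C>0. \<exists>n0::nat. \<forall>n\<ge>n0.
           c * real n \<le> real (lattice_distances \<alpha> n) \<and>
           real (lattice_distances \<alpha> n) \<le> C * real n"
proof -
  have bounds: "1/2 * real n \<le> real (lattice_distances \<alpha> n) \<and>
      real (lattice_distances \<alpha> n) \<le> 4 * real n"
    if n: "1 \<le> n" and small:
      "2 * (2 * real n powr \<alpha> * (1 + ln (2 * real n powr \<alpha>)))\<^sup>2 + 1 \<le> real n / 2" for n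
  proof -
    define X where "X = real n powr (1 - \<alpha>)"
    define Y where "Y = real n powr \<alpha>"
    define a where "a = nat \<lfloor>X\<rfloor>"
    define b where "b = nat \<lfloor>Y\<rfloor>"
    let ?V = "sqnorm ` ({..a} \<times> {..b})"
    have XY: "X * Y = real n"
      using n by (simp add: X_def Y_def flip: powr_add)
    have ge1: "1 \<le> X" "1 \<le> Y"
      using n assms by (simp_all add: X_def Y_def ge_one_powr_ge_zero)
    have a: "real a \<le> X" "X \<le> real (a + 1)" and b: "real b \<le> Y" "Y \<le> real (b + 1)" "1 \<le> b"
      using ge1 unfolding a_def b_def by linarith+
    have D: "lattice_distances \<alpha> n = card ?V - 1"
      by (simp add: lattice_distances_eq a_def b_def X_def Y_def)
    have "real (card ?V) \<le> real (a + 1) * real (b + 1)"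
      using card_image_le[of "{..a} \<times> {..b}" sqnorm]
      by (simp add: card_cartesian_product del: mult_Suc mult_Suc_right of_nat_add of_nat_Suc flip: of_nat_mult)
    \<comment> \<open>Both sides are at least 1, so adding 1 at most doubles them; hence the
      constant 4.\<close>
    also have "\<dots> \<le> (2 * X) * (2 * Y)"
      using a b ge1 by (intro mult_mono) auto
    finally have upper: "real (card ?V) \<le> 4 * real n"
      using XY by simp
    have "X * Y \<le> real (a + 1) * real (b + 1)"
      using a b ge1 by (intro mult_mono) auto
    moreover have "2 * (real (2 * b) * (1 + ln (real (2 * b))))\<^sup>2 \<le> 2 * (2 * Y * (1 + ln (2 * Y)))\<^sup>2"
      using b by (intro mult_left_mono power_mono mult_mono add_mono ln_mono) auto
    ultimately have "real n - 2 * (2 * Y * (1 + ln (2 * Y)))\<^sup>2 \<le> real (card ?V)"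
      using card_sqnorm_image_ge[OF b(3), of a] XY by linarith
    \<comment> \<open>The extra 1 pays for the zero distance, which \<open>D\<close>
      subtracts.\<close>
    then have "1/2 * real n + 1 \<le> real (card ?V)"
      using small by (simp add: Y_def)
    with upper D show ?thesis
      by linarith
  qed
  from eventually_collisions_le[OF assms(2)] eventually_ge_at_top[of 1]
  have "eventually (\<lambda>n. 1/2 * real n \<le> real (lattice_distances \<alpha> n) \<and>
      real (lattice_distances \<alpha> n) \<le> 4 * real n) sequentially"
    by eventually_elim (use bounds in blast)
  then obtain n0 where "\<forall>n\<ge>n0. 1/2 * real n \<le> real (lattice_distances \<alpha> n) \<and>
      real (lattice_distances \<alpha> n) \<le> 4 * real n"
    unfolding eventually_sequentially by blast
  then show ?thesis
    by (intro exI[of _ "1/2::real"] conjI exI[of _ "4::real"] exI[of _ n0]) auto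
qed

end
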